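(* Let $0<x,y<1$, let $m>1$ be an integer, suppose that $x$ and $1-x$ are multiplicatively independent, and let $p,h,u,v$ be rational numbers with $$y=x^p(1-x)^h,\qquad 1-y=x^u(1-x)^v,\qquad pv-hu=-m,\qquad h\neq0.$$ Then the unique rational Nahm matrix for the ordered pair $(x,y)$ is $$A=\frac1h\begin{pmatrix} -p & 1 \\ m & v \end{pmatrix},$$ and with $D=\operatorname{diag}(1,m)$ one has $$\det(AD)=-\frac{mu}{h}.$$ The cross term is positive and $AD$ is positive definite exactly when $h>0$, $p<0$, and $u<0$. A rational linear term can be added to $\tfrac12(r,s)AD(r,s)^T$ to make it integer-valued on $\mathbb Z^2$ exactly when all three entries of the symmetric matrix $AD$ are integers.
   Context: Rational powers are positive real powers. Multiplicatively independent means that $x^i(1-x)^j=1$ with integers $i,j$ forces $i=j=0$. A rational Nahm matrix for the ordered pair $(x,y)=(z_1,z_2)$ is a matrix $A\in M_2(\mathbb Q)$ with $1-z_i=\prod_{j}z_j^{A_{ij}}$ for $i=1,2$, i.e. $1-x=x^{A_{11}}y^{A_{12}}$ and $1-y=x^{A_{21}}y^{A_{22}}$. The cross term is the off-diagonal entry of the symmetric matrix $AD$. A rational linear term is an expression $b_1r+b_2s$ with $b_1,b_2\in\mathbb Q$. *)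

theory Defs
  imports "HOL-Analysis.Analysis"
begin

definition mult_independent :: "real \<Rightarrow> real \<Rightarrow> bool" where
  "mult_independent a b \<longleftrightarrow> (\<forall>i j :: int. a powi i * b powi j = 1 \<longrightarrow> i = 0 \<and> j = 0)"

(* Only used for z with positive components, where powr is the usual positive real power. *)
definition rational_nahm_matrix :: "real^2 \<Rightarrow> rat^2^2 \<Rightarrow> bool" where
  "rational_nahm_matrix z A \<longleftrightarrow>
     (\<forall>i. 1 - z $ i = (\<Prod>j\<in>UNIV. (z $ j) powr real_of_rat (A $ i $ j)))"

(* w^T M w; written as a sum because the inner product is not available over rat. *)
definition quad_form :: "'a::comm_semiring_1^'n^'n \<Rightarrow> 'a^'n \<Rightarrow> 'a" where
  "quad_form M w = (\<Sum>i\<in>UNIV. w $ i * (M *v w) $ i)"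

definition positive_definite :: "real^'n^'n \<Rightarrow> bool" where
  "positive_definite M \<longleftrightarrow> transpose M = M \<and> (\<forall>w. w \<noteq> 0 \<longrightarrow> 0 < quad_form M w)"

end

theory Submission
  imports Defs
begin

text \<open>
  Taking logarithms, multiplicative independence of \<open>x\<close> and \<open>1 - x\<close> says that
  \<open>ln x\<close> and \<open>ln (1 - x)\<close> are linearly independent over the rationals: clear denominators in a
  rational relation (\<open>rational_log_relation_trivial\<close>). Hence a rational monomial in \<open>x\<close> and
  \<open>1 - x\<close> determines its exponents (\<open>rational_powers_unique\<close>).
  The hypotheses express all of \<open>x\<close>, \<open>y\<close>, \<open>1 - x\<close> and \<open>1 - y\<close> in this basis, with exponent vectors \<open>(1, 0)\<close>, \<open>(p, h)\<close>, \<open>(0, 1)\<close> and \<open>(u, v)\<close>. Because \<open>h \<noteq> 0\<close>, the first two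
  vectors are themselves a basis, and the rows of a Nahm matrix are the coordinates of the last two
  in it. Thus each row is the solution of a nonsingular triangular linear system
  (\<open>rational_nahm_matrix_iff_linear\<close>). The relation \<open>p * v - h * u = - m\<close> turns the lower left
  coordinate \<open>u - p * v / h\<close> into \<open>m / h\<close>, which is what makes \<open>AD\<close> symmetric, and it simplifies
  the determinant of \<open>AD\<close> to \<open>- m * u / h\<close>.

  The remaining claims concern the symmetric matrix \<open>AD\<close> with rows \<open>(- p / h, m / h)\<close> and
  \<open>(m / h, m * v / h)\<close>. Positive definiteness is Sylvester's criterion
  (\<open>positive_definite_2_iff\<close>): since \<open>m > 0\<close>, a positive cross term \<open>m / h\<close> means \<open>h > 0\<close>, and then
  the two leading minors \<open>- p / h\<close> and \<open>- m * u / h\<close> are positive exactly when \<open>p\<close> and \<open>u\<close> are negative. For integrality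
  (\<open>integral_quad_form_2_iff\<close>), the entries of \<open>AD\<close> are second differences of the quadratic
  polynomial, in which linear terms cancel; conversely, half the diagonal can be used as linear term,
  since \<open>r * (r + 1)\<close> is always even.
\<close>

section \<open>Rational monomials in multiplicatively independent numbers\<close>

lemma of_rat_common_denominator:
  fixes s t :: rat
  obtains i j n :: int where "n > 0" "s = of_int i / of_int n" "t = of_int j / of_int n"
proof -
  obtain i1 n1 where 1: "s = Fract i1 n1" "n1 > 0" by (cases s) auto
  obtain j1 n2 where 2: "t = Fract j1 n2" "n2 > 0" by (cases t) auto
  show ?thesis
    using 1 2 by (intro that[of "n1 * n2" "i1 * n2" "j1 * n1"]) (auto simp: Fract_of_int_quotient)
qed

text \<open>
  Raising a rational relation between \<open>a\<close> and \<open>b\<close> to the power of a common denominator turns it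
  into an integral one.
\<close>
lemma rational_log_relation_trivial:
  fixes a b :: real and s t :: rat
  assumes "mult_independent a b" "0 < a" "0 < b"
    and rel: "of_rat s * ln a + of_rat t * ln b = 0"
  shows "s = 0 \<and> t = 0"
proof -
  obtain i j n :: int where n: "n > 0" and s: "s = of_int i / of_int n" and t: "t = of_int j / of_int n"
    by (rule of_rat_common_denominator)
  have "of_int i * ln a + of_int j * ln b = of_int n * (of_rat s * ln a + of_rat t * ln b)"
    using n by (simp add: s t of_rat_divide field_simps)
  then have "of_int i * ln a + of_int j * ln b = 0"
    by (simp add: rel)
  then have "a powr of_int i * b powr of_int j = 1"
    using assms(2,3) by (simp add: powr_def flip: exp_add)
  then have "a powi i * b powi j = 1"
    using assms(2,3) by (simp add: powr_real_of_int')
  with assms(1) show ?thesis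
    by (auto simp: mult_independent_def s t)
qed

lemma rational_powers_unique:
  fixes a b :: real and s t s' t' :: rat
  assumes "mult_independent a b" "0 < a" "0 < b"
  shows "a powr of_rat s * b powr of_rat t = a powr of_rat s' * b powr of_rat t' \<longleftrightarrow> s = s' \<and> t = t'"
proof
  assume "a powr of_rat s * b powr of_rat t = a powr of_rat s' * b powr of_rat t'"
  then have "of_rat s * ln a + of_rat t * ln b = of_rat s' * ln a + of_rat t' * ln b"
    using assms(2,3) by (simp add: powr_def flip: exp_add)
  then have "of_rat (s - s') * ln a + of_rat (t - t') * ln b = 0"
    by (simp add: of_rat_diff algebra_simps)
  from rational_log_relation_trivial[OF assms this] show "s = s' \<and> t = t'"
    by simp
qed simp

lemma rational_monomial_substitute:
  fixes a b c :: real and s t p h :: rat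
  assumes "0 < a" "0 < b" "c = a powr of_rat p * b powr of_rat h"
  shows "a powr of_rat s * c powr of_rat t = a powr of_rat (s + p * t) * b powr of_rat (h * t)"
  using assms by (simp add: powr_mult powr_powr powr_add of_rat_add of_rat_mult)

text \<open>
  Each equation defining a Nahm matrix compares two monomials in \<open>x\<close> and \<open>1 - x\<close>, so it is
  equivalent to the equality of their exponents.
\<close>
lemma rational_nahm_matrix_iff_linear:
  fixes x y :: real and p h u v :: rat and A :: "rat^2^2"
  assumes x: "0 < x" "x < 1" and ind: "mult_independent x (1 - x)"
    and y: "y = x powr of_rat p * (1 - x) powr of_rat h"
    and y': "1 - y = x powr of_rat u * (1 - x) powr of_rat v"
  shows "rational_nahm_matrix (vector [x, y]) A \<longleftrightarrow>
    (A$1$1 + p * A$1$2 = 0 \<and> h * A$1$2 = 1) \<and> (A$2$1 + p * A$2$2 = u \<and> h * A$2$2 = v)"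
proof -
  have pos: "0 < 1 - x" using x by simp
  note unique = rational_powers_unique[OF ind x(1) pos]
  have row1: "1 - x = x powr of_rat s * y powr of_rat t \<longleftrightarrow> s + p * t = 0 \<and> h * t = 1" for s t
    unfolding rational_monomial_substitute[OF x(1) pos y]
    using unique[of 0 1 "s + p * t" "h * t"] x by auto
  have row2: "1 - y = x powr of_rat s * y powr of_rat t \<longleftrightarrow> s + p * t = u \<and> h * t = v" for s t
    unfolding rational_monomial_substitute[OF x(1) pos y] y'
    using unique[of u v "s + p * t" "h * t"] by auto
  show ?thesis
    by (simp add: rational_nahm_matrix_def forall_2 UNIV_2 row1 row2)
qed

section \<open>Symmetric two by two matrices\<close>

lemma symmetric_2_entry:
  fixes M :: "'a^2^2"
  assumes "transpose M = M"
  shows "M$2$1 = M$1$2"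
proof -
  have "transpose M $ 1 $ 2 = M$1$2" by (simp only: assms)
  then show ?thesis by (simp add: transpose_def)
qed

lemma quad_form_2:
  fixes M :: "'a::comm_ring_1^2^2"
  assumes "transpose M = M"
  shows "quad_form M w = M$1$1 * (w$1)\<^sup>2 + 2 * M$1$2 * w$1 * w$2 + M$2$2 * (w$2)\<^sup>2"
  by (simp add: symmetric_2_entry[OF assms] quad_form_def matrix_vector_mult_def sum_2
      power2_eq_square algebra_simps)

text \<open>
  Sylvester's criterion in dimension two, by completing the square. The vector \<open>(- M$1$2, M$1$1)\<close> is
  the one at which the completed square vanishes, so it isolates the determinant.
\<close>
lemma positive_definite_2_iff:
  fixes M :: "real^2^2"
  assumes sym: "transpose M = M"
  shows "positive_definite M \<longleftrightarrow> 0 < M$1$1 \<and> 0 < det M"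
proof
  have square: "M$1$1 * quad_form M w = (M$1$1 * w$1 + M$1$2 * w$2)\<^sup>2 + det M * (w$2)\<^sup>2" for w
    by (simp add: quad_form_2[OF sym] det_2 symmetric_2_entry[OF sym] power2_eq_square algebra_simps)
  {
    assume pd: "positive_definite M"
    have "(vector [1, 0] :: real^2) \<noteq> 0"
      by (simp add: vec_eq_iff forall_2)
    with pd have "0 < quad_form M (vector [1, 0])"
      by (simp add: positive_definite_def)
    then have a: "0 < M$1$1"
      by (simp add: quad_form_2[OF sym])
    let ?w = "vector [- M$1$2, M$1$1] :: real^2"
    have "?w \<noteq> 0"
      using a by (simp add: vec_eq_iff forall_2)
    with pd a have "0 < M$1$1 * quad_form M ?w"
      by (simp add: positive_definite_def)
    then have "0 < det M * (M$1$1)\<^sup>2"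
      by (simp add: square)
    with a show "0 < M$1$1 \<and> 0 < det M"
      by (simp add: zero_less_mult_iff)
  }
  assume pos: "0 < M$1$1 \<and> 0 < det M"
  have "0 < quad_form M w" if "w \<noteq> 0" for w
  proof -
    have "0 < (M$1$1 * w$1 + M$1$2 * w$2)\<^sup>2 + det M * (w$2)\<^sup>2"
    proof (cases "w$2 = 0")
      case True
      with that have "w$1 \<noteq> 0" by (simp add: vec_eq_iff forall_2)
      with pos True show ?thesis by simp
    next
      case False
      with pos show ?thesis by (intro add_nonneg_pos) auto
    qed
    with pos show ?thesis by (simp add: zero_less_mult_iff flip: square)
  qed
  with sym show "positive_definite M"
    by (simp add: positive_definite_def)
qed

lemma positive_definite_of_rat_2_iff:
  fixes M :: "rat^2^2"
  assumes "transpose M = M"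
  shows "positive_definite (map_matrix real_of_rat M) \<longleftrightarrow> 0 < M$1$1 \<and> 0 < det M"
proof -
  have "transpose (map_matrix real_of_rat M) = map_matrix real_of_rat M"
    using assms by (simp add: vec_eq_iff transpose_def map_matrix_def)
  moreover have "det (map_matrix real_of_rat M) = of_rat (det M)"
    by (simp add: det_2 map_matrix_def of_rat_diff of_rat_mult)
  ultimately show ?thesis
    by (simp add: positive_definite_2_iff map_matrix_def)
qed

lemma half_consecutive_product_in_Ints:
  fixes c :: rat
  assumes "c \<in> \<int>"
  shows "c * (of_int r * (of_int r + 1) / 2) \<in> \<int>"
proof -
  have "even (r * (r + 1))" by simp
  then obtain k where "r * (r + 1) = 2 * k" by blast
  then have "of_int r * (of_int r + 1) = (2 * of_int k :: rat)"
    by (metis of_int_1 of_int_add of_int_mult of_int_numeral)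
  then show ?thesis using assms by simp
qed

text \<open>
  Writing \<open>f\<close> for the polynomial, \<open>f 1 0 + f (- 1) 0\<close>, \<open>f 0 1 + f 0 (- 1)\<close> and
  \<open>f 1 1 - f 1 0 - f 0 1\<close> are the three entries of the matrix, whatever the linear term is.
\<close>
lemma integral_quad_form_2_iff:
  fixes M :: "rat^2^2"
  assumes sym: "transpose M = M"
  shows "(\<exists>b1 b2 :: rat. \<forall>r s :: int.
            1 / 2 * quad_form M (vector [of_int r, of_int s]) + (b1 * of_int r + b2 * of_int s) \<in> \<int>)
         \<longleftrightarrow> M$1$1 \<in> \<int> \<and> M$1$2 \<in> \<int> \<and> M$2$2 \<in> \<int>"
    (is "(\<exists>b1 b2. \<forall>r s. ?f b1 b2 r s \<in> \<int>) \<longleftrightarrow> _")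
proof
  have f: "?f b1 b2 r s = M$1$1 * (of_int r)\<^sup>2 / 2 + M$1$2 * of_int r * of_int s
      + M$2$2 * (of_int s)\<^sup>2 / 2 + b1 * of_int r + b2 * of_int s" for b1 b2 r s
    by (simp add: quad_form_2[OF sym] add_divide_distrib)
  {
    assume "\<exists>b1 b2. \<forall>r s. ?f b1 b2 r s \<in> \<int>"
    then obtain b1 b2 where int: "?f b1 b2 r s \<in> \<int>" for r s
      by blast
    have "M$1$1 = ?f b1 b2 1 0 + ?f b1 b2 (- 1) 0"
      and "M$2$2 = ?f b1 b2 0 1 + ?f b1 b2 0 (- 1)"
      and "M$1$2 = ?f b1 b2 1 1 - ?f b1 b2 1 0 - ?f b1 b2 0 1"
      unfolding f by simp_all
    then show "M$1$1 \<in> \<int> \<and> M$1$2 \<in> \<int> \<and> M$2$2 \<in> \<int>"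
      by (metis int Ints_add Ints_diff)
  }
  assume int: "M$1$1 \<in> \<int> \<and> M$1$2 \<in> \<int> \<and> M$2$2 \<in> \<int>"
  have "?f (M$1$1 / 2) (M$2$2 / 2) r s = M$1$1 * (of_int r * (of_int r + 1) / 2)
      + M$1$2 * of_int r * of_int s + M$2$2 * (of_int s * (of_int s + 1) / 2)" for r s
    unfolding f by (simp add: power2_eq_square field_simps)
  then have "?f (M$1$1 / 2) (M$2$2 / 2) r s \<in> \<int>" for r s
    using int by (simp only:) (intro Ints_add Ints_mult half_consecutive_product_in_Ints; simp)
  then show "\<exists>b1 b2. \<forall>r s. ?f b1 b2 r s \<in> \<int>"
    by blast
qed

section \<open>The Nahm matrix and its symmetrization\<close>

theorem proposition3p1:
  fixes x y :: real and m :: int and p h u v :: rat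
  assumes "0 < x" "x < 1" "0 < y" "y < 1"
    and "m > 1"
    and "mult_independent x (1 - x)"
    and "y = x powr real_of_rat p * (1 - x) powr real_of_rat h"
    and "1 - y = x powr real_of_rat u * (1 - x) powr real_of_rat v"
    and "p * v - h * u = - of_int m"
    and "h \<noteq> 0"
  shows "let A = vector [vector [- p / h, 1 / h], vector [of_int m / h, v / h]] :: rat^2^2;
             D = vector [vector [1, 0], vector [0, of_int m]] :: rat^2^2;
             AD = A ** D
         in (rational_nahm_matrix (vector [x, y]) A \<and>
               (\<forall>B. rational_nahm_matrix (vector [x, y]) B \<longrightarrow> B = A)) \<and>
            det AD = - (of_int m * u / h) \<and>
            transpose AD = AD \<and>
            (AD $ 1 $ 2 > 0 \<and> positive_definite (map_matrix real_of_rat AD)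
               \<longleftrightarrow> h > 0 \<and> p < 0 \<and> u < 0) \<and>
            ((\<exists>b1 b2 :: rat. \<forall>r s :: int.
                 1 / 2 * quad_form AD (vector [of_int r, of_int s])
                   + (b1 * of_int r + b2 * of_int s) \<in> \<int>)
               \<longleftrightarrow> AD $ 1 $ 1 \<in> \<int> \<and> AD $ 1 $ 2 \<in> \<int> \<and> AD $ 2 $ 2 \<in> \<int>)"
proof -
  define A where "A = (vector [vector [- p / h, 1 / h], vector [of_int m / h, v / h]] :: rat^2^2)"
  define D where "D = (vector [vector [1, 0], vector [0, of_int m]] :: rat^2^2)"
  define AD where "AD = A ** D"
  have h: "h \<noteq> 0" and m: "of_int m = h * u - p * v" and m0: "(of_int m :: rat) > 0"
    using assms by simp_all
  have entries: "AD$1$1 = - p / h" "AD$1$2 = of_int m / h" "AD$2$1 = of_int m / h"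
      "AD$2$2 = of_int m * v / h"
    by (simp_all add: AD_def A_def D_def matrix_matrix_mult_def sum_2)
  note nahm_iff = rational_nahm_matrix_iff_linear[OF assms(1,2,6-8)]
  have solve: "s + p * t = c \<and> h * t = d \<longleftrightarrow> s = c - p * (d / h) \<and> t = d / h" for s t c d
  proof -
    have "h * t = d \<longleftrightarrow> t = d / h" using h by (auto simp: field_simps)
    then show ?thesis by (auto simp: eq_diff_eq)
  qed
  have nahm: "rational_nahm_matrix (vector [x, y]) B \<longleftrightarrow> B = A" for B
  proof -
    have "rational_nahm_matrix (vector [x, y]) B \<longleftrightarrow>
        (B$1$1 = - p / h \<and> B$1$2 = 1 / h) \<and> (B$2$1 = of_int m / h \<and> B$2$2 = v / h)"
      unfolding nahm_iff solve m using h by (auto simp: field_simps)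
    then show ?thesis
      by (auto simp: A_def vec_eq_iff forall_2)
  qed
  have det: "det AD = - (of_int m * u / h)"
    using h by (simp add: det_2 entries m field_simps)
  have sym: "transpose AD = AD"
    by (simp add: vec_eq_iff forall_2 transpose_def entries)
  have pd: "AD$1$2 > 0 \<and> positive_definite (map_matrix real_of_rat AD) \<longleftrightarrow> h > 0 \<and> p < 0 \<and> u < 0"
    unfolding positive_definite_of_rat_2_iff[OF sym] det entries
    using m0 by (auto simp: zero_less_divide_iff divide_less_0_iff mult_less_0_iff)
  show ?thesis
    unfolding Let_def A_def[symmetric] D_def[symmetric] AD_def[symmetric]
    using nahm det sym pd integral_quad_form_2_iff[OF sym] by blast
qed

end
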